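(* Let $S$ be a Hausdorff topological semigroup which contains $\mathscr{I}_{\infty}^{\nearrow}(\mathbb{N})$ as a proper, dense subsemigroup that is discrete in the subspace topology. Then $\mathscr{I}_{\infty}^{\nearrow}(\mathbb{N})$ is an open subsemigroup of $S$ and $S\setminus\mathscr{I}_{\infty}^{\nearrow}(\mathbb{N})$ is a (two-sided) ideal of $S$.
   Context: $\mathbb{N}$ is the set of positive integers. $\mathscr{I}_{\infty}^{\nearrow}(\mathbb{N})$ is the set of all injective, order-preserving (hence strictly increasing) partial maps $\varphi\colon\mathbb{N}\rightharpoonup\mathbb{N}$ such that $\mathbb{N}\setminus\operatorname{dom}\varphi$ and $\mathbb{N}\setminus\operatorname{ran}\varphi$ are finite, where $\operatorname{ran}\varphi$ is the image of $\varphi$. The operation is composition of partial maps written on the right: $x(\alpha\beta)=(x\alpha)\beta$, with $\operatorname{dom}(\alpha\beta)=\{y\in\operatorname{dom}\alpha\mid y\alpha\in\operatorname{dom}\beta\}$. A topological semigroup is a semigroup with a topology for which the multiplication $S\times S\to S$ is (jointly) continuous. *)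

theory Defs
  imports "HOL-Analysis.Analysis"
begin

text \<open>Partial maps of the positive integers are partial maps on \<^typ>\<open>nat\<close> whose domain and
  range avoid \<open>0\<close>. For a partial map \<open>\<phi>\<close>, the condition \<open>inj_on \<phi> (dom \<phi>)\<close> says that \<open>\<phi>\<close> is
  injective as a partial map.\<close>

abbreviation pos_nats :: "nat set" where
  "pos_nats \<equiv> {0<..}"

definition cofin_mono_inj :: "(nat \<rightharpoonup> nat) set" where
  "cofin_mono_inj =
     {\<phi>. dom \<phi> \<subseteq> pos_nats \<and> ran \<phi> \<subseteq> pos_nats \<and>
         inj_on \<phi> (dom \<phi>) \<and> mono_on (dom \<phi>) (\<lambda>x. the (\<phi> x)) \<and>
         finite (pos_nats - dom \<phi>) \<and> finite (pos_nats - ran \<phi>)}"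

text \<open>Maps are written on the right: \<open>x(\<alpha>\<beta>) = (x\<alpha>)\<beta>\<close>, so \<open>\<alpha>\<close> is applied first.\<close>

definition pmult :: "(nat \<rightharpoonup> nat) \<Rightarrow> (nat \<rightharpoonup> nat) \<Rightarrow> (nat \<rightharpoonup> nat)"  (infixl "\<cdot>\<^sub>p" 70) where
  "\<alpha> \<cdot>\<^sub>p \<beta> = \<beta> \<circ>\<^sub>m \<alpha>"

definition subsemigroup :: "'a::semigroup_mult set \<Rightarrow> bool" where
  "subsemigroup T \<longleftrightarrow> T \<noteq> {} \<and> (\<forall>x\<in>T. \<forall>y\<in>T. x * y \<in> T)"

definition semigroup_ideal :: "'a::semigroup_mult set \<Rightarrow> bool" where
  "semigroup_ideal J \<longleftrightarrow> J \<noteq> {} \<and> (\<forall>s. \<forall>x\<in>J. s * x \<in> J \<and> x * s \<in> J)"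

end

theory Submission
  imports Defs
begin

text \<open>
  Write \<open>T\<close> for the image of the semigroup in the ambient space. A point of a discrete set has a
  neighbourhood meeting the set in that point only, and if the set is also dense in a Hausdorff
  space, nothing else can live in this neighbourhood. So every singleton in \<open>T\<close> is open in the
  ambient space, and \<open>T\<close> is open.

  For the ideal property, suppose that \<open>s * x = c\<close> with \<open>c\<close> in \<open>T\<close> and \<open>x\<close> outside \<open>T\<close>. As \<open>{c}\<close> is
  open, continuity of the multiplication yields neighbourhoods \<open>U\<close> of \<open>s\<close> and \<open>V\<close> of \<open>x\<close> with
  \<open>U * V = {c}\<close>. By density \<open>U\<close> contains some \<open>a\<close> of \<open>T\<close>, while \<open>V\<close> contains infinitely many \<open>b\<close>
  of \<open>T\<close>, because \<open>x\<close> is an accumulation point of \<open>T\<close>. Hence the equation \<open>a * b = c\<close> has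
  infinitely many solutions \<open>b\<close> in \<open>T\<close>. The case \<open>x * s = c\<close> is symmetric and leads to the equation
  \<open>b * a = c\<close>; lemma \<open>complement_absorbs\<close> treats both.

  This is impossible here: \<open>finite_left_solutions\<close> and \<open>finite_right_solutions\<close> say that linear
  equations in one unknown have only finitely many solutions. Such an equation prescribes the
  unknown map on a cofinite set, and a monotone map has only finitely many possible values on the
  remaining points, since these values are bounded by the value at one large prescribed point.
\<close>

section \<open>Dense discrete subsemigroups\<close>

text \<open>If \<open>U\<close> isolates \<open>x\<close> in \<open>T\<close>, then \<open>U - {x}\<close> is open and misses the dense set \<open>T\<close>, so it is
  empty.\<close>

lemma open_singleton_of_dense_discrete:
  fixes T :: "'a :: t1_space set"
  assumes dense: "closure T = UNIV" and "discrete T" and "x \<in> T"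
  shows "open {x}"
proof -
  obtain U where U: "open U" "U \<inter> T = {x}"
    using assms(2,3) unfolding discrete_def isolated_in_def by blast
  have "open (U - {x})"
    using U(1) by (simp add: open_delete)
  moreover have "(U - {x}) \<inter> T = {}"
    using U(2) by blast
  ultimately have "(U - {x}) \<inter> closure T = {}"
    by (simp add: open_Int_closure_eq_empty)
  then have "U = {x}"
    using dense U(2) by auto
  with U(1) show ?thesis by simp
qed

lemma infinite_Int_open_of_dense:
  fixes T :: "'a :: t1_space set"
  assumes "closure T = UNIV" and "x \<notin> T" and "open V" and "x \<in> V"
  shows "infinite (V \<inter> T)"
proof -
  have "x islimpt T"
    using assms(1,2) by (auto simp: closure_def)
  then show ?thesis
    using assms(3,4) by (simp add: islimpt_eq_acc_point)
qed

lemma open_rectangle_of_open_product: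
  fixes s x :: "'a :: topological_semigroup_mult"
  assumes "open {s * x}"
  obtains U V where "open U" "s \<in> U" "open V" "x \<in> V"
    "\<And>a b. a \<in> U \<Longrightarrow> b \<in> V \<Longrightarrow> a * b = s * x"
proof -
  have "eventually (\<lambda>p. fst p * snd p \<in> {s * x}) (nhds s \<times>\<^sub>F nhds x)"
    using tendsto_mult_Pair assms by (rule topological_tendstoD) simp
  then obtain P Q where PQ: "eventually P (nhds s)" "eventually Q (nhds x)"
    "\<And>a b. P a \<Longrightarrow> Q b \<Longrightarrow> a * b = s * x"
    unfolding eventually_prod_filter by auto
  from PQ(1) obtain U where U: "open U" "s \<in> U" "\<forall>a\<in>U. P a"
    unfolding eventually_nhds by blast
  from PQ(2) obtain V where V: "open V" "x \<in> V" "\<forall>b\<in>V. Q b"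
    unfolding eventually_nhds by blast
  show ?thesis
    by (rule that[OF U(1,2) V(1,2)]) (use PQ(3) U(3) V(3) in blast)
qed

text \<open>The hypotheses on solution sets are the only algebraic input: all points of \<open>T\<close> near a point
  outside \<open>T\<close> would solve one and the same equation.\<close>

lemma complement_absorbs:
  fixes T :: "'a :: {t1_space, topological_semigroup_mult} set"
  assumes dense: "closure T = UNIV" and "discrete T"
    and left: "\<And>a c. a \<in> T \<Longrightarrow> c \<in> T \<Longrightarrow> finite {b \<in> T. a * b = c}"
    and right: "\<And>a c. a \<in> T \<Longrightarrow> c \<in> T \<Longrightarrow> finite {b \<in> T. b * a = c}"
    and x: "x \<notin> T"
  shows "s * x \<notin> T \<and> x * s \<notin> T"
proof
  have meets: "\<exists>a. a \<in> U \<inter> T" if "open U" "s \<in> U" for U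
    using that dense open_Int_closure_eq_empty[of U T] by auto
  show "s * x \<notin> T"
  proof
    assume c: "s * x \<in> T"
    then have "open {s * x}"
      using open_singleton_of_dense_discrete assms(1,2) by blast
    then obtain U V where UV: "open U" "s \<in> U" "open V" "x \<in> V"
      "\<And>a b. a \<in> U \<Longrightarrow> b \<in> V \<Longrightarrow> a * b = s * x"
      by (rule open_rectangle_of_open_product) blast
    obtain a where a: "a \<in> U" "a \<in> T"
      using meets UV(1,2) by blast
    have "V \<inter> T \<subseteq> {b \<in> T. a * b = s * x}"
      using UV(5) a(1) by blast
    with infinite_Int_open_of_dense[OF dense x UV(3,4)] left[OF a(2) c] show False
      using finite_subset by blast
  qed
  show "x * s \<notin> T"
  proof
    assume c: "x * s \<in> T"
    then have "open {x * s}"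
      using open_singleton_of_dense_discrete assms(1,2) by blast
    then obtain V U where UV: "open V" "x \<in> V" "open U" "s \<in> U"
      "\<And>b a. b \<in> V \<Longrightarrow> a \<in> U \<Longrightarrow> b * a = x * s"
      by (rule open_rectangle_of_open_product) blast
    obtain a where a: "a \<in> U" "a \<in> T"
      using meets UV(3,4) by blast
    have "V \<inter> T \<subseteq> {b \<in> T. b * a = x * s}"
      using UV(5) a(1) by blast
    with infinite_Int_open_of_dense[OF dense x UV(1,2)] right[OF a(2) c] show False
      using finite_subset by blast
  qed
qed

section \<open>Cofinite monotone injective partial maps\<close>

lemma cofin_mono_inj_value_pos:
  assumes "\<alpha> \<in> cofin_mono_inj" and "\<alpha> x = Some y"
  shows "0 < x" and "0 < y"
  using assms unfolding cofin_mono_inj_def by (auto dest: domI ranI)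

lemma cofin_mono_inj_inject:
  assumes "\<alpha> \<in> cofin_mono_inj" and "\<alpha> x = Some z" and "\<alpha> y = Some z"
  shows "x = y"
proof -
  have "inj_on \<alpha> (dom \<alpha>)"
    using assms(1) by (simp add: cofin_mono_inj_def)
  then show ?thesis
    by (rule inj_onD) (use assms(2,3) in auto)
qed

lemma cofin_mono_inj_mono:
  assumes "\<alpha> \<in> cofin_mono_inj" and "\<alpha> x = Some x'" and "\<alpha> y = Some y'" and "x \<le> y"
  shows "x' \<le> y'"
proof -
  have "mono_on (dom \<alpha>) (\<lambda>x. the (\<alpha> x))"
    using assms(1) by (simp add: cofin_mono_inj_def)
  from mono_onD[OF this, of x y] show ?thesis
    using assms(2-4) by (auto simp: dom_def)
qed

lemma pmult_closed:
  assumes "\<alpha> \<in> cofin_mono_inj" and "\<beta> \<in> cofin_mono_inj"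
  shows "\<alpha> \<cdot>\<^sub>p \<beta> \<in> cofin_mono_inj"
proof -
  note val = cofin_mono_inj_value_pos[OF assms(1)] cofin_mono_inj_value_pos[OF assms(2)]
  have Some: "(\<alpha> \<cdot>\<^sub>p \<beta>) x = Some z \<longleftrightarrow> (\<exists>y. \<alpha> x = Some y \<and> \<beta> y = Some z)" for x z
    by (auto simp: pmult_def map_comp_Some_iff)
  have fin: "finite (pos_nats - dom \<alpha>)" "finite (pos_nats - ran \<alpha>)"
    "finite (pos_nats - dom \<beta>)" "finite (pos_nats - ran \<beta>)"
    using assms by (auto simp: cofin_mono_inj_def)
  have "inj_on (\<lambda>x. the (\<alpha> x)) (dom \<alpha>)"
    using cofin_mono_inj_inject[OF assms(1)] by (auto simp: inj_on_def dom_def)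
  then have "finite ((\<lambda>x. the (\<alpha> x)) -` (pos_nats - dom \<beta>) \<inter> dom \<alpha>)"
    using fin(3) by (rule finite_vimage_IntI[rotated])
  moreover have "pos_nats - dom (\<alpha> \<cdot>\<^sub>p \<beta>) \<subseteq>
      (pos_nats - dom \<alpha>) \<union> ((\<lambda>x. the (\<alpha> x)) -` (pos_nats - dom \<beta>) \<inter> dom \<alpha>)"
    using val(2) by (fastforce simp: dom_def Some)
  ultimately have dom: "finite (pos_nats - dom (\<alpha> \<cdot>\<^sub>p \<beta>))"
    using fin(1) by (meson finite_Un finite_subset)
  have "pos_nats - ran (\<alpha> \<cdot>\<^sub>p \<beta>) \<subseteq>
      (pos_nats - ran \<beta>) \<union> (\<lambda>y. the (\<beta> y)) ` (pos_nats - ran \<alpha>)"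
  proof
    fix z assume z: "z \<in> pos_nats - ran (\<alpha> \<cdot>\<^sub>p \<beta>)"
    show "z \<in> (pos_nats - ran \<beta>) \<union> (\<lambda>y. the (\<beta> y)) ` (pos_nats - ran \<alpha>)"
    proof (cases "z \<in> ran \<beta>")
      case True
      then obtain y where y: "\<beta> y = Some z"
        by (auto simp: ran_def)
      then have "y \<in> pos_nats - ran \<alpha>"
        using z val(3) by (auto simp: ran_def Some)
      with y show ?thesis
        by (auto intro!: image_eqI[of _ _ y])
    qed (use z in blast)
  qed
  then have ran: "finite (pos_nats - ran (\<alpha> \<cdot>\<^sub>p \<beta>))"
    using fin(2,4) by (meson finite_Un finite_imageI finite_subset)
  have "mono_on (dom (\<alpha> \<cdot>\<^sub>p \<beta>)) (\<lambda>x. the ((\<alpha> \<cdot>\<^sub>p \<beta>) x))"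
  proof (rule mono_onI)
    fix x y assume "x \<in> dom (\<alpha> \<cdot>\<^sub>p \<beta>)" "y \<in> dom (\<alpha> \<cdot>\<^sub>p \<beta>)" and le: "x \<le> y"
    then obtain x'' y'' where c: "(\<alpha> \<cdot>\<^sub>p \<beta>) x = Some x''" "(\<alpha> \<cdot>\<^sub>p \<beta>) y = Some y''"
      by auto
    then obtain x' y' where *: "\<alpha> x = Some x'" "\<beta> x' = Some x''" "\<alpha> y = Some y'" "\<beta> y' = Some y''"
      unfolding Some by blast
    then have "x'' \<le> y''"
      using cofin_mono_inj_mono[OF assms(1)] cofin_mono_inj_mono[OF assms(2)] le by blast
    then show "the ((\<alpha> \<cdot>\<^sub>p \<beta>) x) \<le> the ((\<alpha> \<cdot>\<^sub>p \<beta>) y)"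
      by (simp add: c)
  qed
  moreover have "inj_on (\<alpha> \<cdot>\<^sub>p \<beta>) (dom (\<alpha> \<cdot>\<^sub>p \<beta>))"
  proof (rule inj_onI)
    fix x y assume "x \<in> dom (\<alpha> \<cdot>\<^sub>p \<beta>)" and eq: "(\<alpha> \<cdot>\<^sub>p \<beta>) x = (\<alpha> \<cdot>\<^sub>p \<beta>) y"
    then obtain z where "(\<alpha> \<cdot>\<^sub>p \<beta>) x = Some z" "(\<alpha> \<cdot>\<^sub>p \<beta>) y = Some z"
      unfolding dom_def by fastforce
    then show "x = y"
      unfolding Some
      using cofin_mono_inj_inject[OF assms(1)] cofin_mono_inj_inject[OF assms(2)] by metis
  qed
  moreover have "dom (\<alpha> \<cdot>\<^sub>p \<beta>) \<subseteq> pos_nats" "ran (\<alpha> \<cdot>\<^sub>p \<beta>) \<subseteq> pos_nats"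
    using val by (auto simp: dom_def ran_def Some)
  ultimately show ?thesis
    using dom ran by (simp add: cofin_mono_inj_def)
qed

section \<open>Finiteness of the solution sets\<close>

text \<open>A member of \<open>P\<close> is determined by its restriction to the finite complement \<open>A\<close> of
  \<open>D\<close>. Beyond \<open>A\<close> the members share a point \<open>n\<close> of their domains together with its image \<open>m\<close>, and
  by monotonicity every value taken on \<open>A\<close> is at most \<open>m\<close>.\<close>

lemma finite_if_agree_on_cofinite:
  assumes P: "P \<subseteq> cofin_mono_inj" and D: "finite (pos_nats - D)"
    and agree: "\<And>\<beta> \<beta>' x. \<beta> \<in> P \<Longrightarrow> \<beta>' \<in> P \<Longrightarrow> x \<in> D \<Longrightarrow> \<beta> x = \<beta>' x"
  shows "finite P"
proof (cases "P = {}")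
  case False
  then obtain \<beta>\<^sub>0 where \<beta>\<^sub>0: "\<beta>\<^sub>0 \<in> P" by blast
  define A where "A = pos_nats - D"
  have A: "finite A" using D by (simp add: A_def)
  have "finite (A \<union> (pos_nats - dom \<beta>\<^sub>0))"
    using A \<beta>\<^sub>0 P by (auto simp: cofin_mono_inj_def)
  \<comment> \<open>A positive \<open>n\<close> above all points missing from \<open>D\<close> or from \<open>dom \<beta>\<^sub>0\<close> belongs to both sets.\<close>
  then obtain k where "\<forall>x \<in> A \<union> (pos_nats - dom \<beta>\<^sub>0). x < k"
    unfolding finite_nat_set_iff_bounded by blast
  then obtain n where n: "\<forall>x \<in> A \<union> (pos_nats - dom \<beta>\<^sub>0). x < n" "0 < n"
    using that[of "Suc k"] by (simp add: less_SucI)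
  then have "n \<in> D" "n \<in> dom \<beta>\<^sub>0"
    by (auto simp: A_def)
  then obtain m where m: "\<beta>\<^sub>0 n = Some m" by blast
  have bound: "y \<le> m" if "\<beta> \<in> P" "x \<in> A" "\<beta> x = Some y" for \<beta> x y
  proof -
    have "\<beta> n = Some m"
      using agree[OF that(1) \<beta>\<^sub>0 \<open>n \<in> D\<close>] m by simp
    moreover have "x \<le> n"
      using n(1) that(2) by (simp add: less_imp_le)
    ultimately show ?thesis
      using cofin_mono_inj_mono that P by blast
  qed
  have "(\<lambda>\<beta>. \<beta> |` A) ` P \<subseteq> (\<Union>X\<in>Pow A. {f. dom f = X \<and> ran f \<subseteq> {..m}})"
    using bound by (auto simp: ran_def restrict_map_def split: if_splits)
  moreover have "finite (\<Union>X\<in>Pow A. {f :: nat \<rightharpoonup> nat. dom f = X \<and> ran f \<subseteq> {..m}})"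
    using A by (auto intro!: finite_set_of_finite_maps intro: finite_subset)
  ultimately have "finite ((\<lambda>\<beta>. \<beta> |` A) ` P)"
    by (rule finite_subset)
  moreover have "inj_on (\<lambda>\<beta>. \<beta> |` A) P"
  proof (intro inj_onI ext)
    fix \<beta> \<beta>' x assume *: "\<beta> \<in> P" "\<beta>' \<in> P" "\<beta> |` A = \<beta>' |` A"
    consider "x \<in> D" | "x \<in> A" | "x = 0"
      by (auto simp: A_def)
    then show "\<beta> x = \<beta>' x"
    proof cases
      case 2
      then show ?thesis using *(3) by (metis restrict_in)
    next
      case 3
      \<comment> \<open>The type contains the non-positive number \<open>0\<close>, where all these maps are undefined.\<close>
      have "\<beta> 0 = None" "\<beta>' 0 = None"
        using *(1,2) P cofin_mono_inj_value_pos(1) by (metis less_irrefl not_None_eq subsetD)+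
      then show ?thesis using 3 by simp
    qed (use agree * in blast)
  qed
  ultimately show ?thesis
    by (rule finite_imageD)
qed simp

text \<open>The equation fixes \<open>\<beta>\<close> on the cofinite set \<open>ran \<alpha>\<close>.\<close>

lemma finite_left_solutions:
  assumes "\<alpha> \<in> cofin_mono_inj"
  shows "finite {\<beta> \<in> cofin_mono_inj. \<alpha> \<cdot>\<^sub>p \<beta> = \<gamma>}"
proof (rule finite_if_agree_on_cofinite)
  show "finite (pos_nats - ran \<alpha>)"
    using assms by (simp add: cofin_mono_inj_def)
  fix \<beta> \<beta>' y
  assume \<beta>: "\<beta> \<in> {\<beta> \<in> cofin_mono_inj. \<alpha> \<cdot>\<^sub>p \<beta> = \<gamma>}" "\<beta>' \<in> {\<beta> \<in> cofin_mono_inj. \<alpha> \<cdot>\<^sub>p \<beta> = \<gamma>}"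
    and "y \<in> ran \<alpha>"
  then obtain x where "\<alpha> x = Some y"
    by (auto simp: ran_def)
  then have "\<beta> y = (\<alpha> \<cdot>\<^sub>p \<beta>) x" "\<beta>' y = (\<alpha> \<cdot>\<^sub>p \<beta>') x"
    by (simp_all add: pmult_def map_comp_def)
  with \<beta> show "\<beta> y = \<beta>' y" by simp
qed blast

text \<open>Since \<open>\<alpha>\<close> can be cancelled by injectivity, the equation fixes \<open>\<beta>\<close> on the cofinite set
  \<open>dom \<gamma>\<close>.\<close>

lemma finite_right_solutions:
  assumes "\<alpha> \<in> cofin_mono_inj" and "\<gamma> \<in> cofin_mono_inj"
  shows "finite {\<beta> \<in> cofin_mono_inj. \<beta> \<cdot>\<^sub>p \<alpha> = \<gamma>}"
proof (rule finite_if_agree_on_cofinite)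
  show "finite (pos_nats - dom \<gamma>)"
    using assms(2) by (simp add: cofin_mono_inj_def)
  fix \<beta> \<beta>' x
  assume \<beta>: "\<beta> \<in> {\<beta> \<in> cofin_mono_inj. \<beta> \<cdot>\<^sub>p \<alpha> = \<gamma>}" "\<beta>' \<in> {\<beta> \<in> cofin_mono_inj. \<beta> \<cdot>\<^sub>p \<alpha> = \<gamma>}"
    and "x \<in> dom \<gamma>"
  then obtain z where "\<gamma> x = Some z" by blast
  with \<beta> have "(\<beta> \<cdot>\<^sub>p \<alpha>) x = Some z" "(\<beta>' \<cdot>\<^sub>p \<alpha>) x = Some z"
    by simp_all
  then obtain y y' where y: "\<beta> x = Some y" "\<alpha> y = Some z" "\<beta>' x = Some y'" "\<alpha> y' = Some z"
    by (auto simp: pmult_def map_comp_Some_iff)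
  then have "y = y'"
    using cofin_mono_inj_inject assms(1) by blast
  with y show "\<beta> x = \<beta>' x" by simp
qed blast

section \<open>Discrete dense embeddings into topological semigroups\<close>

theorem theorem3p4:
  fixes e :: "(nat \<rightharpoonup> nat) \<Rightarrow> 'a :: {t2_space, topological_semigroup_mult}"
  assumes inj: "inj_on e cofin_mono_inj"
    and hom: "\<And>\<alpha> \<beta>. \<alpha> \<in> cofin_mono_inj \<Longrightarrow> \<beta> \<in> cofin_mono_inj \<Longrightarrow> e (\<alpha> \<cdot>\<^sub>p \<beta>) = e \<alpha> * e \<beta>"
    and proper: "e ` cofin_mono_inj \<noteq> UNIV"
    and dense: "closure (e ` cofin_mono_inj) = UNIV"
    and discrete: "discrete (e ` cofin_mono_inj)"
  shows "open (e ` cofin_mono_inj) \<and> subsemigroup (e ` cofin_mono_inj) \<and>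
         semigroup_ideal (UNIV - e ` cofin_mono_inj)"
proof -
  let ?I = cofin_mono_inj and ?T = "e ` cofin_mono_inj"
  have "open (\<Union>x\<in>?T. {x})"
    using open_singleton_of_dense_discrete[OF dense discrete] by blast
  then have "open ?T" by simp
  have "?T \<noteq> {}"
    using dense by (metis UNIV_not_empty closure_empty)
  then have "subsemigroup ?T"
    unfolding subsemigroup_def using pmult_closed by (auto simp flip: hom)
  have left: "finite {b \<in> ?T. a * b = c}" if "a \<in> ?T" "c \<in> ?T" for a c
  proof -
    obtain \<alpha> \<gamma> where \<alpha>: "\<alpha> \<in> ?I" "a = e \<alpha>" "\<gamma> \<in> ?I" "c = e \<gamma>"
      using \<open>a \<in> ?T\<close> \<open>c \<in> ?T\<close> by blast
    have "{b \<in> ?T. a * b = c} \<subseteq> e ` {\<beta> \<in> ?I. \<alpha> \<cdot>\<^sub>p \<beta> = \<gamma>}"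
      using \<alpha> by (auto simp: pmult_closed inj_on_eq_iff[OF inj] simp flip: hom)
    then show ?thesis
      using finite_left_solutions[OF \<alpha>(1)] by (meson finite_imageI finite_subset)
  qed
  have right: "finite {b \<in> ?T. b * a = c}" if "a \<in> ?T" "c \<in> ?T" for a c
  proof -
    obtain \<alpha> \<gamma> where \<alpha>: "\<alpha> \<in> ?I" "a = e \<alpha>" "\<gamma> \<in> ?I" "c = e \<gamma>"
      using \<open>a \<in> ?T\<close> \<open>c \<in> ?T\<close> by blast
    have "{b \<in> ?T. b * a = c} \<subseteq> e ` {\<beta> \<in> ?I. \<beta> \<cdot>\<^sub>p \<alpha> = \<gamma>}"
      using \<alpha> by (auto simp: pmult_closed inj_on_eq_iff[OF inj] simp flip: hom)
    then show ?thesis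
      using finite_right_solutions[OF \<alpha>(1,3)] by (meson finite_imageI finite_subset)
  qed
  have "s * x \<notin> ?T \<and> x * s \<notin> ?T" if "x \<notin> ?T" for s x
    by (rule complement_absorbs[OF dense discrete]) (rule left right that; assumption)+
  then have "semigroup_ideal (UNIV - ?T)"
    using proper unfolding semigroup_ideal_def by blast
  with \<open>open ?T\<close> \<open>subsemigroup ?T\<close> show ?thesis by simp
qed

end
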